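(* Let $\alpha\in\Gamma$, $\lambda\in\mathbb{C}\setminus\mathbb{R}$, $f\in\ell^2_\Psi(\mathbb{N}_0)$, and let system (S$_\lambda$) be definite on $\mathbb{N}_0$. Then the function $$\hat z_k(\lambda)=\sum_{l=0}^\infty G_{k,l}(\lambda)\Psi_l f_l,\qquad k\in\mathbb{N}_0,$$ solves the nonhomogeneous system (S$_\lambda^f$), satisfies the initial condition $\alpha\hat z_0(\lambda)=0$, is square summable, i.e. $\hat z(\lambda)\in\ell^2_\Psi(\mathbb{N}_0)$, and $$\|\hat z(\lambda)\|_\Psi\le\frac{1}{|\Im(\lambda)|}\|f\|_\Psi.$$ In addition, if system (S$_\lambda$) is in the limit point case for all $\lambda\in\mathbb{C}\setminus\mathbb{R}$ or in the limit circle case for all $\lambda\in\mathbb{C}\setminus\mathbb{R}$, then $$\lim_{k\to\infty}\mathcal{X}_k^{+*}(\nu)\,\mathcal{J}\,\hat z_k(\lambda)=0\quad\text{for every }\nu\in\mathbb{C}\setminus\mathbb{R}.$$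
   Context: Let $n\in\mathbb{N}$, $\mathbb{N}_0=\{0,1,2,\dots\}$ and $\mathcal{J}=\begin{pmatrix}0&I_n\\-I_n&0\end{pmatrix}$. For each $k\in\mathbb{N}_0$ let $S_k,\Psi_k\in\mathbb{C}^{2n\times2n}$ satisfy $S_k^*\mathcal{J}S_k=\mathcal{J}$, $\Psi_k^*=\Psi_k\ge0$ (positive semi-definite) and $\Psi_k\mathcal{J}\Psi_k=0$. Put $V_k=-\mathcal{J}\Psi_kS_k$ and $\mathbb{S}_k(\lambda)=S_k+\lambda V_k$, $\lambda\in\mathbb{C}$; these matrices are invertible. System (S$_\lambda$) is $z_k(\lambda)=\mathbb{S}_k(\lambda)z_{k+1}(\lambda)$, $k\in\mathbb{N}_0$, and the nonhomogeneous system (S$_\lambda^f$) is $z_k(\lambda)=\mathbb{S}_k(\lambda)z_{k+1}(\lambda)-\mathcal{J}\Psi_kf_k$, $k\in\mathbb{N}_0$. The superscript in $A^*(\lambda)$ means $(A(\lambda))^*$. $\ell^2_\Psi(\mathbb{N}_0)$ is the space of sequences $z=(z_k)_{k\in\mathbb{N}_0}$ in $\mathbb{C}^{2n}$ with $\|z\|_\Psi=\big(\sum_{k=0}^\infty z_k^*\Psi_kz_k\big)^{1/2}<\infty$ ("square summable"). System (S$_\lambda$) is definite on $\mathbb{N}_0$ if for each $\lambda\in\mathbb{C}$ and every nontrivial solution $z(\lambda)$ of (S$_\lambda$) one has $\sum_{k\in\mathbb{N}_0}z_k^*(\lambda)\Psi_kz_k(\lambda)>0$. $\Gamma=\{\alpha\in\mathbb{C}^{n\times2n}:\alpha\alpha^*=I,\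 \alpha\mathcal{J}\alpha^*=0\}$. For $\alpha\in\Gamma$, $\Phi(\lambda,\alpha)=(Z(\lambda,\alpha),\ \widetilde Z(\lambda,\alpha))$ is the fundamental matrix of (S$_\lambda$) with $\Phi_0(\lambda,\alpha)=(\alpha^*,\ -\mathcal{J}\alpha^* )$, partitioned in $2n\times n$ blocks; write $\widetilde Z(\lambda)=\widetilde Z(\lambda,\alpha)$. For $M\in\mathbb{C}^{n\times n}$ let $\mathcal{X}_k(\lambda)=\Phi_k(\lambda,\alpha)\begin{pmatrix}I\\ M\end{pmatrix}$ (Weyl solution) and, for $\lambda\in\mathbb{C}\setminus\mathbb{R}$, $\mathcal{E}_k(M)=i\,\mathrm{sgn}(\Im\lambda)\,\mathcal{X}_k^*(\lambda)\mathcal{J}\mathcal{X}_k(\lambda)$, $D_k(\lambda)=\{M\in\mathbb{C}^{n\times n}:\mathcal{E}_k(M)\le0\}$ (Weyl disk); the sets $D_k(\lambda)$ decrease in $k$, and $D_+(\lambda)=\lim_{k\to\infty}D_k(\lambda)=\bigcap_kD_k(\lambda)$. For $\lambda\in\mathbb{C}\setminus\mathbb{R}$, system (S$_\lambda$) is in the limit point case if it has exactly $n$ linearly independent square summable solutions, and in the limit circle case if it has $2n$ of them. $M_+(\lambda)$, $\lambda\in\mathbb{C}\setminus\mathbb{R}$, is the half-line Weyl–Titchmarsh $M(\lambda)$-function: it is a function $M_+:\mathbb{C}\setminus\mathbb{R}\to\mathbb{C}^{n\times n}$ with $M_+(\lambda)\in D_+(\lambda)$ and $M_+^*(\lambda)=M_+(\bar\lambda)$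 for all $\lambda\in\mathbb{C}\setminus\mathbb{R}$, and such that, with $\mathcal{X}^+_k(\lambda)=\Phi_k(\lambda,\alpha)\begin{pmatrix}I\\ M_+(\lambda)\end{pmatrix}$, one has $\lim_{k\to\infty}\mathcal{X}_k^{+*}(\lambda)\mathcal{J}\mathcal{X}_k^+(\nu)=0$ whenever $\lambda,\nu\in\mathbb{C}\setminus\mathbb{R}$ and (S$_\lambda$), (S$_\nu$) are both in the limit point case or both in the limit circle case. The columns of $\mathcal{X}^+(\lambda)$ are square summable. The Green function is, for $\lambda\in\mathbb{C}\setminus\mathbb{R}$ and $k,l\in\mathbb{N}_0$, $$G_{k,l}(\lambda)=\begin{cases}\widetilde Z_k(\lambda)\,\mathcal{X}_l^{+*}(\bar\lambda),&0\le k\le l,\\ \mathcal{X}_k^+(\lambda)\,\widetilde Z_l^*(\bar\lambda),&k\ge l+1.\end{cases}$$ *)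

theory Defs
  imports "HOL-Analysis.Analysis" "HOL-Library.Function_Algebras"
begin

text \<open>
  The index type \<open>'n\<close> has \<open>n\<close> elements; \<open>\<complex>\<close>-vectors of length \<open>2n\<close> are indexed by \<open>'n + 'n\<close>, so that
  \<open>Inl\<close> and \<open>Inr\<close> select the first and the second half. A \<open>p\<close> by \<open>q\<close> matrix has type
  \<open>complex^'q^'p\<close>.
\<close>

type_synonym 'n cvec2 = "complex^('n + 'n)"
type_synonym 'n cmat2 = "complex^('n + 'n)^('n + 'n)"

definition adj :: "complex^'q^'p \<Rightarrow> complex^'p^'q"
  where "adj A = (\<chi> i j. cnj (A $ j $ i))"

definition hcat :: "complex^'n^'p \<Rightarrow> complex^'n^'p \<Rightarrow> complex^('n + 'n)^'p"
  where "hcat A B = (\<chi> i j. case j of Inl a \<Rightarrow> A $ i $ a | Inr b \<Rightarrow> B $ i $ b)"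

definition vcat :: "complex^'p^'n \<Rightarrow> complex^'p^'n \<Rightarrow> complex^'p^('n + 'n)"
  where "vcat A B = (\<chi> i. case i of Inl a \<Rightarrow> A $ a | Inr b \<Rightarrow> B $ b)"

definition right_block :: "complex^('n + 'n)^'p \<Rightarrow> complex^'n^'p"
  where "right_block A = (\<chi> i j. A $ i $ Inr j)"

definition J :: "'n::finite cmat2"
  where "J = vcat (hcat 0 (mat 1)) (hcat (- mat 1) 0)"

text \<open>The form \<open>v\<^sup>* A v\<close>, and semi-definiteness of Hermitian matrices.\<close>

definition qform :: "complex^'p^'p \<Rightarrow> complex^'p \<Rightarrow> complex"
  where "qform A v = (\<Sum>i\<in>UNIV. cnj (v $ i) * (A *v v) $ i)"

definition psd :: "complex^'p^'p \<Rightarrow> bool"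
  where "psd A \<longleftrightarrow> adj A = A \<and> (\<forall>v. 0 \<le> Re (qform A v))"

definition nsd :: "complex^'p^'p \<Rightarrow> bool"
  where "nsd A \<longleftrightarrow> adj A = A \<and> (\<forall>v. Re (qform A v) \<le> 0)"


definition V_coeff :: "(nat \<Rightarrow> 'n::finite cmat2) \<Rightarrow> (nat \<Rightarrow> 'n cmat2) \<Rightarrow> nat \<Rightarrow> 'n cmat2"
  where "V_coeff S \<Psi> k = - (J ** \<Psi> k ** S k)"

definition S_coeff ::
  "(nat \<Rightarrow> 'n::finite cmat2) \<Rightarrow> (nat \<Rightarrow> 'n cmat2) \<Rightarrow> complex \<Rightarrow> nat \<Rightarrow> 'n cmat2"
  where "S_coeff S \<Psi> lam k = S k + mat lam ** V_coeff S \<Psi> k"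

definition solution ::
  "(nat \<Rightarrow> 'n::finite cmat2) \<Rightarrow> (nat \<Rightarrow> 'n cmat2) \<Rightarrow> complex \<Rightarrow> (nat \<Rightarrow> 'n cvec2) \<Rightarrow> bool"
  where "solution S \<Psi> lam z \<longleftrightarrow> (\<forall>k. z k = S_coeff S \<Psi> lam k *v z (Suc k))"

definition nonhom_solution ::
  "(nat \<Rightarrow> 'n::finite cmat2) \<Rightarrow> (nat \<Rightarrow> 'n cmat2) \<Rightarrow> complex \<Rightarrow>
   (nat \<Rightarrow> 'n cvec2) \<Rightarrow> (nat \<Rightarrow> 'n cvec2) \<Rightarrow> bool"
  where "nonhom_solution S \<Psi> lam f z \<longleftrightarrow>
    (\<forall>k. z k = S_coeff S \<Psi> lam k *v z (Suc k) - (J ** \<Psi> k) *v f k)"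


text \<open>
  For positive semi-definite \<open>\<Psi> k\<close> the terms \<open>z\<^sub>k\<^sup>* \<Psi>\<^sub>k z\<^sub>k\<close> are real and nonnegative, so taking the real
  part only changes the type. The value of \<open>l2_norm\<close> is meaningful on \<open>l2_space\<close> only.
\<close>

definition l2_space :: "(nat \<Rightarrow> 'n::finite cmat2) \<Rightarrow> (nat \<Rightarrow> 'n cvec2) set"
  where "l2_space \<Psi> = {z. summable (\<lambda>k. Re (qform (\<Psi> k) (z k)))}"

definition l2_norm :: "(nat \<Rightarrow> 'n::finite cmat2) \<Rightarrow> (nat \<Rightarrow> 'n cvec2) \<Rightarrow> real"
  where "l2_norm \<Psi> z = sqrt (\<Sum>k. Re (qform (\<Psi> k) (z k)))"

text \<open>The sum in the definiteness condition may be infinite, hence the values in \<open>ennreal\<close>.\<close>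

definition definite :: "(nat \<Rightarrow> 'n::finite cmat2) \<Rightarrow> (nat \<Rightarrow> 'n cmat2) \<Rightarrow> bool"
  where "definite S \<Psi> \<longleftrightarrow>
    (\<forall>lam z. solution S \<Psi> lam z \<and> z \<noteq> (\<lambda>_. 0) \<longrightarrow>
      (\<Sum>k. ennreal (Re (qform (\<Psi> k) (z k)))) > 0)"


text \<open>Sequences of complex vectors as a complex vector space, to count linearly independent solutions.\<close>

definition seq_scale :: "complex \<Rightarrow> (nat \<Rightarrow> complex^'p) \<Rightarrow> nat \<Rightarrow> complex^'p"
  where "seq_scale c z = (\<lambda>k. c *s z k)"

lemma vector_space_seq_scale: "vector_space (seq_scale :: complex \<Rightarrow> (nat \<Rightarrow> complex^'p) \<Rightarrow> _)"
  by unfold_locales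
    (auto simp: seq_scale_def fun_eq_iff vec_eq_iff algebra_simps)

definition num_l2_solutions :: "(nat \<Rightarrow> 'n::finite cmat2) \<Rightarrow> (nat \<Rightarrow> 'n cmat2) \<Rightarrow> complex \<Rightarrow> nat"
  where "num_l2_solutions S \<Psi> lam =
    vector_space.dim seq_scale {z. solution S \<Psi> lam z \<and> z \<in> l2_space \<Psi>}"

definition limit_point :: "(nat \<Rightarrow> 'n::finite cmat2) \<Rightarrow> (nat \<Rightarrow> 'n cmat2) \<Rightarrow> complex \<Rightarrow> bool"
  where "limit_point S \<Psi> lam \<longleftrightarrow> num_l2_solutions S \<Psi> lam = CARD('n)"

definition limit_circle :: "(nat \<Rightarrow> 'n::finite cmat2) \<Rightarrow> (nat \<Rightarrow> 'n cmat2) \<Rightarrow> complex \<Rightarrow> bool"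
  where "limit_circle S \<Psi> lam \<longleftrightarrow> num_l2_solutions S \<Psi> lam = 2 * CARD('n)"


definition \<Gamma> :: "(complex^('n + 'n)^'n::finite) set"
  where "\<Gamma> = {\<alpha>. \<alpha> ** adj \<alpha> = mat 1 \<and> \<alpha> ** J ** adj \<alpha> = 0}"

text \<open>
  The fundamental matrix is computed forward from its value at \<open>0\<close>; the coefficient matrices are
  invertible, so it is the unique solution of the matrix system with that value (see
  \<open>fund_unique\<close> below).
\<close>

primrec fund ::
  "(nat \<Rightarrow> 'n::finite cmat2) \<Rightarrow> (nat \<Rightarrow> 'n cmat2) \<Rightarrow> complex^('n + 'n)^'n \<Rightarrow> complex \<Rightarrow>
   nat \<Rightarrow> 'n cmat2"
  where
    "fund S \<Psi> \<alpha> lam 0 = hcat (adj \<alpha>) (- (J ** adj \<alpha>))"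
  | "fund S \<Psi> \<alpha> lam (Suc k) = matrix_inv (S_coeff S \<Psi> lam k) ** fund S \<Psi> \<alpha> lam k"

definition Z_tilde ::
  "(nat \<Rightarrow> 'n::finite cmat2) \<Rightarrow> (nat \<Rightarrow> 'n cmat2) \<Rightarrow> complex^('n + 'n)^'n \<Rightarrow> complex \<Rightarrow>
   nat \<Rightarrow> complex^'n^('n + 'n)"
  where "Z_tilde S \<Psi> \<alpha> lam k = right_block (fund S \<Psi> \<alpha> lam k)"

definition weyl_sol ::
  "(nat \<Rightarrow> 'n::finite cmat2) \<Rightarrow> (nat \<Rightarrow> 'n cmat2) \<Rightarrow> complex^('n + 'n)^'n \<Rightarrow> complex \<Rightarrow>
   complex^'n^'n \<Rightarrow> nat \<Rightarrow> complex^'n^('n + 'n)"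
  where "weyl_sol S \<Psi> \<alpha> lam M k = fund S \<Psi> \<alpha> lam k ** vcat (mat 1) M"

definition E_form ::
  "(nat \<Rightarrow> 'n::finite cmat2) \<Rightarrow> (nat \<Rightarrow> 'n cmat2) \<Rightarrow> complex^('n + 'n)^'n \<Rightarrow> complex \<Rightarrow>
   nat \<Rightarrow> complex^'n^'n \<Rightarrow> complex^'n^'n"
  where "E_form S \<Psi> \<alpha> lam k M =
    mat (\<i> * of_real (sgn (Im lam))) ** (adj (weyl_sol S \<Psi> \<alpha> lam M k) ** J ** weyl_sol S \<Psi> \<alpha> lam M k)"

definition weyl_disk ::
  "(nat \<Rightarrow> 'n::finite cmat2) \<Rightarrow> (nat \<Rightarrow> 'n cmat2) \<Rightarrow> complex^('n + 'n)^'n \<Rightarrow> complex \<Rightarrow>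
   nat \<Rightarrow> (complex^'n^'n) set"
  where "weyl_disk S \<Psi> \<alpha> lam k = {M. nsd (E_form S \<Psi> \<alpha> lam k M)}"

definition limiting_disk ::
  "(nat \<Rightarrow> 'n::finite cmat2) \<Rightarrow> (nat \<Rightarrow> 'n cmat2) \<Rightarrow> complex^('n + 'n)^'n \<Rightarrow> complex \<Rightarrow>
   (complex^'n^'n) set"
  where "limiting_disk S \<Psi> \<alpha> lam = (\<Inter>k. weyl_disk S \<Psi> \<alpha> lam k)"

text \<open>
  \<open>half_line_M S \<Psi> \<alpha> M\<close>: the function \<open>M\<close> is a half-line Weyl--Titchmarsh function of the system.
  Only its values off the real axis matter.
\<close>

definition half_line_M ::
  "(nat \<Rightarrow> 'n::finite cmat2) \<Rightarrow> (nat \<Rightarrow> 'n cmat2) \<Rightarrow> complex^('n + 'n)^'n \<Rightarrow>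
   (complex \<Rightarrow> complex^'n^'n) \<Rightarrow> bool"
  where "half_line_M S \<Psi> \<alpha> M \<longleftrightarrow>
    (\<forall>lam. lam \<notin> \<real> \<longrightarrow> M lam \<in> limiting_disk S \<Psi> \<alpha> lam \<and> adj (M lam) = M (cnj lam)) \<and>
    (\<forall>lam \<nu>. lam \<notin> \<real> \<and> \<nu> \<notin> \<real> \<and>
       (limit_point S \<Psi> lam \<and> limit_point S \<Psi> \<nu> \<or> limit_circle S \<Psi> lam \<and> limit_circle S \<Psi> \<nu>) \<longrightarrow>
       (\<lambda>k. adj (weyl_sol S \<Psi> \<alpha> lam (M lam) k) ** J ** weyl_sol S \<Psi> \<alpha> \<nu> (M \<nu>) k) \<longlonglongrightarrow> 0)"

definition green ::
  "(nat \<Rightarrow> 'n::finite cmat2) \<Rightarrow> (nat \<Rightarrow> 'n cmat2) \<Rightarrow> complex^('n + 'n)^'n \<Rightarrow>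
   (complex \<Rightarrow> complex^'n^'n) \<Rightarrow> complex \<Rightarrow> nat \<Rightarrow> nat \<Rightarrow> 'n cmat2"
  where "green S \<Psi> \<alpha> M lam k l =
    (if k \<le> l
     then Z_tilde S \<Psi> \<alpha> lam k ** adj (weyl_sol S \<Psi> \<alpha> (cnj lam) (M (cnj lam)) l)
     else weyl_sol S \<Psi> \<alpha> lam (M lam) k ** adj (Z_tilde S \<Psi> \<alpha> (cnj lam) l))"

definition z_hat ::
  "(nat \<Rightarrow> 'n::finite cmat2) \<Rightarrow> (nat \<Rightarrow> 'n cmat2) \<Rightarrow> complex^('n + 'n)^'n \<Rightarrow>
   (complex \<Rightarrow> complex^'n^'n) \<Rightarrow> complex \<Rightarrow> (nat \<Rightarrow> 'n cvec2) \<Rightarrow> nat \<Rightarrow> 'n cvec2"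
  where "z_hat S \<Psi> \<alpha> M lam f k = (\<Sum>l. (green S \<Psi> \<alpha> M lam k l ** \<Psi> l) *v f l)"


lemma mat_mult_left: "mat c ** A = (\<chi> i j. c * A $ i $ j)" for A :: "complex^'q^'p"
  by (simp add: vec_eq_iff matrix_matrix_mult_def mat_def mult_delta_left)

lemma mat_mult_right: "A ** mat c = mat c ** A" for A :: "complex^'p^'p"
  unfolding mat_mult_left
  by (simp add: vec_eq_iff matrix_matrix_mult_def mat_def mult_delta_right mult.commute)

lemma matrix_add_right: "(A + B) ** C = A ** C + B ** C" for A :: "complex^'q^'p"
  by (simp add: vec_eq_iff matrix_matrix_mult_def sum.distrib ring_distribs)

lemma matrix_minus_left: "(- A) ** B = - (A ** B)" for A :: "complex^'q^'p"
  by (simp add: vec_eq_iff matrix_matrix_mult_def sum_negf)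

lemma matrix_minus_right: "A ** (- B) = - (A ** B)" for A :: "complex^'q^'p"
  by (simp add: vec_eq_iff matrix_matrix_mult_def sum_negf)

lemma matrix_mult_zero_right: "A ** 0 = 0" for A :: "complex^'q^'p"
  by (simp add: vec_eq_iff matrix_matrix_mult_def)

lemma sum_UNIV_Plus:
  "(\<Sum>i\<in>UNIV. g i) = (\<Sum>a\<in>UNIV. g (Inl a)) + (\<Sum>b\<in>UNIV. g (Inr b))"
  for g :: "'a::finite + 'b::finite \<Rightarrow> 'c::comm_monoid_add"
  unfolding UNIV_Plus_UNIV[symmetric] by (subst sum.Plus) simp_all

lemma J_J: "(J :: 'n::finite cmat2) ** J = - mat 1"
proof -
  have "(\<Sum>k\<in>UNIV. J $ i $ k * J $ k $ j) = (- mat 1 :: 'n cmat2) $ i $ j" for i j :: "'n + 'n"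
    by (cases i; cases j)
      (simp_all add: sum_UNIV_Plus J_def vcat_def hcat_def mat_def mult_delta_left mult_delta_right
        sum_negf)
  then show ?thesis
    by (simp add: vec_eq_iff matrix_matrix_mult_def)
qed

lemma invertible_S_coeff:
  fixes S \<Psi> :: "nat \<Rightarrow> 'n::finite cmat2"
  assumes "adj (S k) ** J ** S k = J" and "\<Psi> k ** J ** \<Psi> k = 0"
  shows "invertible (S_coeff S \<Psi> lam k)"
proof -
  define N where "N = mat lam ** (J ** \<Psi> k)"
  have "N ** N = mat lam ** ((J ** \<Psi> k ** mat lam) ** (J ** \<Psi> k))"
    by (simp only: N_def matrix_mul_assoc)
  also have "\<dots> = mat lam ** (mat lam ** (J ** (\<Psi> k ** J ** \<Psi> k)))"
    by (simp only: mat_mult_right[of "J ** \<Psi> k"] matrix_mul_assoc)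
  also have "\<dots> = 0"
    by (simp only: assms(2) matrix_mult_zero_right)
  finally have NN: "N ** N = 0" .
  have "(mat 1 + N) ** (mat 1 + - N) = mat 1"
    by (simp only: matrix_add_ldistrib matrix_add_right matrix_minus_right matrix_mul_lid
        matrix_mul_rid NN) simp
  then have 1: "invertible (mat 1 + - N)"
    using invertible_left_inverse by blast
  have "(- (J ** adj (S k) ** J)) ** S k = - (J ** (adj (S k) ** J ** S k))"
    by (simp only: matrix_minus_left matrix_mul_assoc)
  also have "\<dots> = mat 1"
    by (simp only: assms(1) J_J) simp
  finally have 2: "invertible (S k)"
    using invertible_left_inverse by blast
  have "S_coeff S \<Psi> lam k = (mat 1 + - N) ** S k"
    by (simp only: S_coeff_def V_coeff_def N_def matrix_add_right matrix_minus_left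
        matrix_minus_right matrix_mul_assoc matrix_mul_lid)
  with invertible_mult[OF 1 2] show ?thesis
    by (simp only:)
qed

lemma matrix_inv_mult_both:
  fixes A :: "complex^'p^'p"
  assumes "invertible A"
  shows "A ** matrix_inv A = mat 1 \<and> matrix_inv A ** A = mat 1"
  using assms unfolding invertible_def matrix_inv_def by (rule someI_ex)

lemma fund_unique:
  fixes S \<Psi> :: "nat \<Rightarrow> 'n::finite cmat2"
  assumes "\<And>k. adj (S k) ** J ** S k = J" and "\<And>k. \<Psi> k ** J ** \<Psi> k = 0"
  shows "F = fund S \<Psi> \<alpha> lam \<longleftrightarrow>
    F 0 = hcat (adj \<alpha>) (- (J ** adj \<alpha>)) \<and> (\<forall>k. F k = S_coeff S \<Psi> lam k ** F (Suc k))"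
    (is "_ \<longleftrightarrow> ?R")
proof
  note inv = matrix_inv_mult_both[OF invertible_S_coeff[of S _ \<Psi> lam, OF assms]]
  show ?R if "F = fund S \<Psi> \<alpha> lam"
    by (simp only: that fund.simps matrix_mul_assoc inv matrix_mul_lid) simp
  assume R: ?R
  have F: "F k = S_coeff S \<Psi> lam k ** F (Suc k)" for k
    using R by blast
  have "F k = fund S \<Psi> \<alpha> lam k" for k
  proof (induction k)
    case 0
    show ?case unfolding fund.simps using R by (rule conjunct1)
  next
    case (Suc k)
    have "fund S \<Psi> \<alpha> lam (Suc k) =
        matrix_inv (S_coeff S \<Psi> lam k) ** (S_coeff S \<Psi> lam k ** F (Suc k))"
      by (simp only: fund.simps Suc[symmetric] F[symmetric])
    also have "\<dots> = F (Suc k)"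
      by (simp only: matrix_mul_assoc inv matrix_mul_lid)
    finally show ?case by (rule sym)
  qed
  then show "F = fund S \<Psi> \<alpha> lam" by (rule ext)
qed

end

theory Submission
  imports Defs
begin

text \<open>
  Everything rests on the Green identity, which turns the boundary form \<open>w\<^sup>* J z\<close> into a telescoping
  sum of \<open>\<Psi>\<close>-forms. For a truncated \<open>f\<close> the function \<open>z\<close> given by the Green function is eventually a
  Weyl solution \<open>X c\<close>, so the disk condition fixes the sign of \<open>i z\<^sup>* J z\<close> there; with
  \<open>z\<^sub>0\<^sup>* J z\<^sub>0 = 0\<close> and Cauchy--Schwarz this yields the norm bound, which passes to the limit because
  the truncations give the partial sums of the series. For the boundary condition at infinity, the
  form \<open>X\<^sup>*(\<nu>) J z\<close> is bounded by a constant times the norm of \<open>f\<close>, uniformly in \<open>k\<close>, and it tends to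
  \<open>0\<close> for truncated \<open>f\<close>, hence for all \<open>f\<close>.
\<close>

section \<open>Hermitian forms\<close>

text \<open>Conjugate-linear in the first argument, so that \<open>cip u (A *v v)\<close> is the
  form \<open>u\<^sup>* A v\<close>, of which \<open>qform\<close> is the diagonal.\<close>

definition cip :: "complex^'p \<Rightarrow> complex^'p \<Rightarrow> complex"
  where "cip u v = (\<Sum>i\<in>UNIV. cnj (u $ i) * v $ i)"

lemma cip_commute: "cnj (cip u v) = cip v u"
  by (simp add: cip_def mult.commute)

lemma cip_add_left: "cip (u + u') v = cip u v + cip u' v"
  by (simp add: cip_def sum.distrib algebra_simps)

lemma cip_add_right: "cip u (v + v') = cip u v + cip u v'"
  by (simp add: cip_def sum.distrib algebra_simps)

lemma cip_minus_left: "cip (- u) v = - cip u v"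
  by (simp add: cip_def sum_negf)

lemma cip_minus_right: "cip u (- v) = - cip u v"
  by (simp add: cip_def sum_negf)

lemma cip_diff_left: "cip (u - u') v = cip u v - cip u' v"
  by (simp add: cip_def sum_subtractf algebra_simps)

lemma cip_diff_right: "cip u (v - v') = cip u v - cip u v'"
  by (simp add: cip_def sum_subtractf algebra_simps)

lemma cip_scale_left: "cip (c *s u) v = cnj c * cip u v"
  by (simp add: cip_def sum_distrib_left algebra_simps)

lemma cip_scale_right: "cip u (c *s v) = c * cip u v"
  by (simp add: cip_def sum_distrib_left algebra_simps)

lemma cip_zero_left [simp]: "cip 0 v = 0"
  by (simp add: cip_def)

lemma cip_zero_right [simp]: "cip u 0 = 0"
  by (simp add: cip_def)

lemma cip_axis_left: "cip (axis i 1) v = v $ i"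
proof -
  have "cip (axis i 1) v = (\<Sum>j\<in>UNIV. if j = i then v $ j else 0)"
    unfolding cip_def by (rule sum.cong) (auto simp: axis_def)
  then show ?thesis by simp
qed

lemmas cip_linear = cip_add_left cip_add_right cip_minus_left cip_minus_right cip_diff_left
  cip_diff_right cip_scale_left cip_scale_right

lemma cip_adj_right: "cip u (adj A *v v) = cip (A *v u) v"
  for A :: "complex^'q^'p"
proof -
  have "cip u (adj A *v v) = (\<Sum>i\<in>UNIV. \<Sum>j\<in>UNIV. cnj (u $ i) * (cnj (A $ j $ i) * v $ j))"
    by (simp add: cip_def matrix_vector_mult_def adj_def sum_distrib_left)
  also have "\<dots> = (\<Sum>j\<in>UNIV. \<Sum>i\<in>UNIV. cnj (u $ i) * (cnj (A $ j $ i) * v $ j))"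
    by (rule sum.swap)
  also have "\<dots> = cip (A *v u) v"
    by (simp add: cip_def matrix_vector_mult_def sum_distrib_right sum_distrib_left algebra_simps)
  finally show ?thesis .
qed

lemma bounded_linear_cip: "bounded_linear (cip u)"
  unfolding cip_def
  by (intro bounded_linear_sum bounded_linear_mult_right[THEN bounded_linear_compose]
      bounded_linear_vec_nth)

lemma adj_adj [simp]: "adj (adj A) = A"
  by (simp add: adj_def vec_eq_iff)

lemma adj_mult: "adj (A ** B) = adj B ** adj A"
  for A :: "complex^'q^'p"
  by (simp add: adj_def vec_eq_iff matrix_matrix_mult_def mult.commute)

lemma adj_J: "adj J = - (J :: 'n::finite cmat2)"
proof -
  have "adj J $ i $ j = (- J :: 'n cmat2) $ i $ j" for i j :: "'n + 'n"
    by (cases i; cases j) (simp_all add: adj_def J_def vcat_def hcat_def mat_def)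
  then show ?thesis by (simp add: vec_eq_iff)
qed

lemma matrix_vector_mult_minus_left: "(- A) *v v = - (A *v v)"
  for A :: "complex^'q^'p"
  by (simp add: vec_eq_iff matrix_vector_mult_def sum_negf)

lemma matrix_vector_mult_minus_right: "A *v (- v) = - (A *v v)"
  for A :: "complex^'q^'p"
  by (simp add: vec_eq_iff matrix_vector_mult_def sum_negf)

lemma matrix_vector_mult_mat: "mat c *v v = c *s v"
  for v :: "complex^'p"
  by (simp add: vec_eq_iff matrix_vector_mult_def mat_def mult_delta_left)

lemma J_J_vec: "J *v (J *v v) = - (v :: complex^('n::finite + 'n))"
  by (simp add: matrix_vector_mul_assoc J_J matrix_vector_mult_minus_left)

lemma cip_J_left: "cip (J *v u) v = - cip u (J *v v)"
  for u :: "complex^('n::finite + 'n)"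
proof -
  have "cip (J *v u) v = cip u (adj J *v v)"
    by (simp add: cip_adj_right)
  then show ?thesis
    by (simp add: adj_J matrix_vector_mult_minus_left cip_linear)
qed

lemma qform_cip: "qform A v = cip v (A *v v)"
  by (simp add: qform_def cip_def)

lemma psd_cip_left: "psd A \<Longrightarrow> cip (A *v u) v = cip u (A *v v)"
  by (metis cip_adj_right psd_def)

lemma psd_qform_real: "psd A \<Longrightarrow> qform A v = of_real (Re (qform A v))"
  by (metis Reals_cnj_iff cip_commute of_real_Re psd_cip_left qform_cip)

lemma psd_qform_nonneg: "psd A \<Longrightarrow> 0 \<le> Re (qform A v)"
  by (simp add: psd_def)

text \<open>The discriminant argument, with separate treatment of null vectors, since the form may
  be degenerate.\<close>

lemma psd_Cauchy_Schwarz: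
  assumes "psd A"
  shows "(cmod (cip u (A *v v)))\<^sup>2 \<le> Re (qform A u) * Re (qform A v)"
proof -
  define c where "c = cip u (A *v v)"
  define s where "s = (cmod c)\<^sup>2"
  have cc: "c * cnj c = of_real s" "cnj c * c = of_real s"
    by (simp_all add: s_def complex_norm_square mult.commute del: of_real_power)
  have c': "cip v (A *v u) = cnj c"
    by (metis assms c_def cip_commute psd_cip_left)
  \<comment> \<open>Turning \<open>v\<close> by \<open>cnj c\<close> makes both cross terms equal to
    \<open>t * s\<close>, so a quadratic in one real variable results.\<close>
  have quad: "0 \<le> Re (qform A u) + 2 * t * s + t\<^sup>2 * s * Re (qform A v)" for t
  proof -
    have "qform A (u + (of_real t * cnj c) *s v) =
        qform A u + of_real t * (cnj c * c) + of_real t * (c * cnj c)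
        + of_real t ^ 2 * (c * cnj c) * qform A v"
      by (simp add: qform_cip cip_linear matrix_vector_right_distrib vector_scalar_commute
          c' flip: c_def) (simp add: algebra_simps power2_eq_square)
    also have "Re \<dots> = Re (qform A u) + 2 * t * s + t\<^sup>2 * s * Re (qform A v)"
      unfolding cc by (subst (2) psd_qform_real[OF assms])
        (simp flip: of_real_power of_real_mult of_real_add)
    finally show ?thesis
      using psd_qform_nonneg[OF assms] by metis
  qed
  have s0: "0 \<le> s" by (simp add: s_def)
  have "s \<le> Re (qform A u) * Re (qform A v)"
  proof (cases "s = 0 \<or> Re (qform A v) = 0")
    case True
    moreover have "s = 0" if "Re (qform A v) = 0"
    proof (rule ccontr)
      assume "s \<noteq> 0"
      then show False
        \<comment> \<open>If \<open>v\<close> is null, the quadratic is affine in \<open>t\<close>,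
          and this \<open>t\<close> gives it the value -1.\<close>
        using quad[of "- (Re (qform A u) + 1) / (2 * s)"] that by (simp add: field_simps)
    qed
    ultimately show ?thesis
      using psd_qform_nonneg[OF assms] by auto
  next
    case False
    then have q: "0 < Re (qform A v)" "0 < s"
      using psd_qform_nonneg[OF assms, of v] s0 by auto
    have "0 \<le> Re (qform A u) - s / Re (qform A v)"
      \<comment> \<open>This \<open>t\<close> is the minimiser of the quadratic.\<close>
      using quad[of "- 1 / Re (qform A v)"] q by (simp add: field_simps power2_eq_square)
    then show ?thesis
      using q by (simp add: field_simps)
  qed
  then show ?thesis by (simp add: s_def c_def)
qed

lemma psd_cip_le:
  assumes "psd A"
  shows "cmod (cip u (A *v v)) \<le> sqrt (Re (qform A u)) * sqrt (Re (qform A v))"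
  using real_le_rsqrt[OF psd_Cauchy_Schwarz[OF assms, of u v]] by (simp add: real_sqrt_mult)

section \<open>The Green identity\<close>

locale symplectic_system =
  fixes S \<Psi> :: "nat \<Rightarrow> complex^('n::finite + 'n)^('n + 'n)"
  assumes S: "\<And>k. adj (S k) ** J ** S k = J"
    and \<Psi>: "\<And>k. psd (\<Psi> k)" "\<And>k. \<Psi> k ** J ** \<Psi> k = 0"
begin

lemma \<Psi>_J_\<Psi>: "\<Psi> k *v (J *v (\<Psi> k *v v)) = 0"
  by (simp add: matrix_vector_mul_assoc \<Psi> matrix_mul_assoc)

lemma \<Psi>_cip_left: "cip (\<Psi> k *v u) v = cip u (\<Psi> k *v v)"
  by (rule psd_cip_left[OF \<Psi>(1)])

lemma cip_S: "cip (S k *v u) (J *v (S k *v v)) = cip u (J *v v)"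
  by (metis S cip_adj_right matrix_vector_mul_assoc)

lemma S_coeff_vec:
  "S_coeff S \<Psi> lam k *v v = S k *v v - lam *s (J *v (\<Psi> k *v (S k *v v)))"
  by (simp add: S_coeff_def V_coeff_def matrix_vector_mult_add_rdistrib matrix_minus_right
      matrix_vector_mult_diff_rdistrib
      matrix_vector_mult_minus_left matrix_vector_mul_assoc[symmetric] matrix_vector_mult_mat)

text \<open>The part of the coefficient that depends on \<open>lam\<close> has the left factor
  \<open>J ** \<Psi> k\<close>, which \<open>\<Psi> k\<close> annihilates.\<close>

lemma \<Psi>_S_coeff: "\<Psi> k *v (S_coeff S \<Psi> lam k *v v) = \<Psi> k *v (S k *v v)"
  by (simp add: S_coeff_vec matrix_vector_mult_diff_distrib vector_scalar_commute \<Psi>_J_\<Psi>)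

text \<open>In the expansion the constant term is the form of \<open>J\<close> because
  \<open>S k\<close> is symplectic, the two linear terms combine to the factor
  \<open>lam - cnj \<nu>\<close>, and the term with \<open>lam * cnj \<nu>\<close> vanishes by
  \<open>\<Psi>_J_\<Psi>\<close>.\<close>

lemma cip_J_S_coeff:
  "cip (S_coeff S \<Psi> \<nu> k *v u) (J *v (S_coeff S \<Psi> lam k *v v)) =
    cip u (J *v v) + (lam - cnj \<nu>) * cip (S_coeff S \<Psi> \<nu> k *v u) (\<Psi> k *v (S_coeff S \<Psi> lam k *v v))"
proof -
  show ?thesis
    unfolding \<Psi>_S_coeff
    by (simp add: S_coeff_vec matrix_vector_mult_diff_distrib vector_scalar_commute cip_linear
        J_J_vec cip_S cip_J_left \<Psi>_cip_left \<Psi>_J_\<Psi> algebra_simps)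
qed

text \<open>The system expresses the coefficient times the value at \<open>Suc k\<close> as the
  value at \<open>k\<close> plus a vector \<open>J *v (\<Psi> k *v _)\<close>. Inserting this in
  \<open>cip_J_S_coeff\<close> leaves the added vectors only in first order, since products with
  \<open>J\<close> between two factors \<open>\<Psi> k\<close> vanish.\<close>

lemma green_identity:
  assumes z: "nonhom_solution S \<Psi> lam f z" and w: "nonhom_solution S \<Psi> \<nu> g w"
  shows "cip (w (Suc k)) (J *v z (Suc k)) = cip (w k) (J *v z k) - cip (w k) (\<Psi> k *v f k)
    + cip (g k) (\<Psi> k *v z k) - (lam - cnj \<nu>) * cip (w k) (\<Psi> k *v z k)"
proof -
  have z': "S_coeff S \<Psi> lam k *v z (Suc k) = z k + J *v (\<Psi> k *v f k)"
    using z unfolding nonhom_solution_def by (metis diff_add_cancel matrix_vector_mul_assoc)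
  have w': "S_coeff S \<Psi> \<nu> k *v w (Suc k) = w k + J *v (\<Psi> k *v g k)"
    using w unfolding nonhom_solution_def by (metis diff_add_cancel matrix_vector_mul_assoc)
  have *: "cip (J *v (\<Psi> k *v x)) (\<Psi> k *v y) = 0" for x y
    by (simp add: \<Psi>_cip_left[symmetric] \<Psi>_J_\<Psi>)
  have "cip (w k + J *v (\<Psi> k *v g k)) (J *v (z k + J *v (\<Psi> k *v f k))) =
      cip (w k) (J *v z k) - cip (w k) (\<Psi> k *v f k) + cip (g k) (\<Psi> k *v z k)"
    by (simp add: matrix_vector_right_distrib cip_linear J_J_vec * cip_J_left \<Psi>_cip_left \<Psi>_J_\<Psi>)
  moreover have "cip (w k + J *v (\<Psi> k *v g k)) (\<Psi> k *v (z k + J *v (\<Psi> k *v f k))) =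
      cip (w k) (\<Psi> k *v z k)"
    by (simp add: matrix_vector_right_distrib \<Psi>_J_\<Psi> cip_linear \<Psi>_cip_left[symmetric])
  ultimately show ?thesis
    using cip_J_S_coeff[of \<nu> k "w (Suc k)" lam "z (Suc k)"] unfolding z' w'
    by (simp add: eq_diff_eq)
qed

lemma green_identity_sum:
  assumes "nonhom_solution S \<Psi> lam f z" and "nonhom_solution S \<Psi> \<nu> g w"
  shows "cip (w K) (J *v z K) = cip (w 0) (J *v z 0) - (\<Sum>k<K. cip (w k) (\<Psi> k *v f k))
    + (\<Sum>k<K. cip (g k) (\<Psi> k *v z k)) - (lam - cnj \<nu>) * (\<Sum>k<K. cip (w k) (\<Psi> k *v z k))"
  by (induction K) (simp_all add: green_identity[OF assms] algebra_simps)

section \<open>Square summable sequences and Cauchy-Schwarz for sums\<close>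

lemma l2_space_iff: "z \<in> l2_space \<Psi> \<longleftrightarrow> summable (\<lambda>k. Re (qform (\<Psi> k) (z k)))"
  by (simp add: l2_space_def)

lemma l2_spaceI_bounded:
  assumes "\<And>K. (\<Sum>k<K. Re (qform (\<Psi> k) (z k))) \<le> C"
  shows "z \<in> l2_space \<Psi>"
proof -
  have "(\<Sum>k\<le>K. norm (Re (qform (\<Psi> k) (z k)))) \<le> C" for K
    using assms[of "Suc K"] psd_qform_nonneg[OF \<Psi>(1)] by (simp add: lessThan_Suc_atMost)
  then have "summable (\<lambda>k. norm (Re (qform (\<Psi> k) (z k))))"
    by (intro bounded_imp_summable) auto
  then show ?thesis
    unfolding l2_space_iff by (rule summable_norm_cancel)
qed

lemma sum_qform_le_l2_norm:
  assumes "z \<in> l2_space \<Psi>"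
  shows "sqrt (\<Sum>k<K. Re (qform (\<Psi> k) (z k))) \<le> l2_norm \<Psi> z"
  unfolding l2_norm_def
  using assms psd_qform_nonneg[OF \<Psi>(1)] by (auto simp: l2_space_iff intro!: sum_le_suminf)

text \<open>Cauchy-Schwarz twice: for each form \<open>\<Psi> k\<close>, then for the sum over
  \<open>k\<close>. Finite sums allow its use in \<open>z_hat_trunc_bound\<close>, before square
  summability of the solution is known.\<close>

lemma sum_cip_le_partial:
  "(\<Sum>k<K. cmod (cip (u k) (\<Psi> k *v v k))) \<le>
    sqrt (\<Sum>k<K. Re (qform (\<Psi> k) (u k))) * sqrt (\<Sum>k<K. Re (qform (\<Psi> k) (v k)))"
proof -
  let ?q = "\<lambda>w k. sqrt (Re (qform (\<Psi> k) (w k)))"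
  have "(\<Sum>k<K. cmod (cip (u k) (\<Psi> k *v v k))) \<le> (\<Sum>k<K. \<bar>?q u k\<bar> * \<bar>?q v k\<bar>)"
    by (intro sum_mono) (simp add: psd_cip_le[OF \<Psi>(1)] psd_qform_nonneg[OF \<Psi>(1)])
  also have "\<dots> \<le> L2_set (?q u) {..<K} * L2_set (?q v) {..<K}"
    by (rule L2_set_mult_ineq)
  finally show ?thesis
    by (simp add: L2_set_def psd_qform_nonneg[OF \<Psi>(1)])
qed

lemma l2_norm_nonneg: "z \<in> l2_space \<Psi> \<Longrightarrow> 0 \<le> l2_norm \<Psi> z"
  using sum_qform_le_l2_norm[of z 0] by simp

lemma sum_cip_le:
  assumes "u \<in> l2_space \<Psi>" "v \<in> l2_space \<Psi>"
  shows "(\<Sum>k<K. cmod (cip (u k) (\<Psi> k *v v k))) \<le> l2_norm \<Psi> u * l2_norm \<Psi> v"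
  using sum_cip_le_partial
    mult_mono[OF sum_qform_le_l2_norm[OF assms(1)] sum_qform_le_l2_norm[OF assms(2)]]
    l2_norm_nonneg[OF assms(1)]
  by (meson order_trans psd_qform_nonneg[OF \<Psi>(1)] real_sqrt_ge_zero sum_nonneg)

lemma norm_sum_cip_le:
  assumes "u \<in> l2_space \<Psi>" "v \<in> l2_space \<Psi>"
  shows "cmod (\<Sum>k<K. cip (u k) (\<Psi> k *v v k)) \<le> l2_norm \<Psi> u * l2_norm \<Psi> v"
  using norm_sum sum_cip_le[OF assms] by (rule order_trans)

lemma summable_norm_cip:
  assumes "u \<in> l2_space \<Psi>" "v \<in> l2_space \<Psi>"
  shows "summable (\<lambda>k. cmod (cip (u k) (\<Psi> k *v v k)))"
  by (rule bounded_imp_summable)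
    (auto simp del: sum.lessThan_Suc simp: lessThan_Suc_atMost[symmetric] intro: sum_cip_le[OF assms])

end

section \<open>Weyl solutions\<close>

lemma adj_hcat: "adj (hcat A B) = vcat (adj A) (adj B)"
  for A B :: "complex^'n::finite^'p::finite"
proof -
  have "adj (hcat A B) $ i $ j = vcat (adj A) (adj B) $ i $ j" for i j
    by (cases i) (simp_all add: adj_def hcat_def vcat_def)
  then show ?thesis by (simp add: vec_eq_iff)
qed

lemma vcat_mult: "vcat A B ** C = vcat (A ** C) (B ** C)"
  for A B :: "complex^'p::finite^'n::finite" and C :: "complex^'q::finite^'p"
proof -
  have "(vcat A B ** C) $ i $ j = vcat (A ** C) (B ** C) $ i $ j" for i j
    by (cases i) (simp_all add: matrix_matrix_mult_def vcat_def)
  then show ?thesis by (simp add: vec_eq_iff)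
qed

lemma mult_hcat: "C ** hcat A B = hcat (C ** A) (C ** B)"
  for A B :: "complex^'n::finite^'p::finite" and C :: "complex^'p^'q::finite"
proof -
  have "(C ** hcat A B) $ i $ j = hcat (C ** A) (C ** B) $ i $ j" for i j
    by (cases j) (simp_all add: matrix_matrix_mult_def hcat_def)
  then show ?thesis by (simp add: vec_eq_iff)
qed

text \<open>As a product with a constant matrix, the right block inherits the equations satisfied by
  \<open>fund\<close>.\<close>

lemma right_block_eq_mult: "right_block A = A ** vcat 0 (mat 1)"
  for A :: "complex^('n::finite + 'n)^'p::finite"
proof -
  have "right_block A $ i $ j = (A ** vcat 0 (mat 1)) $ i $ j" for i j
    by (simp add: right_block_def matrix_matrix_mult_def vcat_def sum_UNIV_Plus mat_def
        mult_delta_right)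
  then show ?thesis by (simp add: vec_eq_iff)
qed

text \<open>Both products have \<open>A\<close> in the lower right corner, where it cancels. This is
  the constant factor in the jump of the Green function across the diagonal.\<close>

lemma vcat_adj_minus_eq_J:
  "vcat (mat 1) A ** adj (vcat 0 (mat 1)) - vcat 0 (mat 1) ** adj (vcat (mat 1) (adj A)) = J"
  for A :: "complex^'n::finite^'n"
proof -
  have cnj_if: "cnj (if P then 1 else 0) = (if P then 1 else 0)" for P
    by simp
  have "(vcat (mat 1) A ** adj (vcat 0 (mat 1)) - vcat 0 (mat 1) ** adj (vcat (mat 1) (adj A)))
      $ i $ j = (J :: 'n cmat2) $ i $ j" for i j
    by (cases i; cases j) (auto simp: matrix_matrix_mult_def adj_def vcat_def hcat_def J_def
        mat_def mult_delta_left mult_delta_right cnj_if)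
  then show ?thesis by (simp add: vec_eq_iff)
qed

lemma cip_eqI: "(\<And>u. cip u v = cip u w) \<Longrightarrow> v = w"
  by (metis cip_axis_left vec_eq_iff)

text \<open>The hypothesis says that \<open>- (J ** adj A ** J)\<close> is a left inverse of
  \<open>B\<close>; for square matrices it is also a right inverse.\<close>

lemma J_unitary_right:
  fixes A B :: "'n::finite cmat2"
  assumes "adj A ** J ** B = J"
  shows "B ** J ** adj A = J"
proof -
  have "(- (J ** adj A ** J)) ** B = mat 1"
    using assms by (simp add: matrix_minus_left J_J flip: matrix_mul_assoc)
  then have "B ** (- (J ** adj A ** J)) = mat 1"
    by (simp add: matrix_left_right_inverse)
  then have "(B ** J ** adj A) ** J = - mat 1"
    by (simp add: matrix_minus_right matrix_mul_assoc minus_equation_iff[of _ "mat 1"])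
  then have "(B ** J ** adj A) ** (J ** J) = - J"
    by (simp add: matrix_mul_assoc matrix_minus_left)
  then show ?thesis
    by (simp add: J_J matrix_minus_right)
qed

lemma cnj_not_real: "lam \<notin> \<real> \<Longrightarrow> cnj lam \<notin> \<real>"
  by (simp add: complex_is_Real_iff)

locale half_line_system = symplectic_system S \<Psi>
  for S \<Psi> :: "nat \<Rightarrow> complex^('n::finite + 'n)^('n + 'n)" +
  fixes \<alpha> :: "complex^('n + 'n)^'n" and M :: "complex \<Rightarrow> complex^'n^'n"
  assumes \<alpha>: "\<alpha> \<in> \<Gamma>"
    and M: "half_line_M S \<Psi> \<alpha> M"
begin

abbreviation X :: "complex \<Rightarrow> nat \<Rightarrow> complex^'n^('n + 'n)"
  where "X lam \<equiv> weyl_sol S \<Psi> \<alpha> lam (M lam)"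

abbreviation Zt :: "complex \<Rightarrow> nat \<Rightarrow> complex^'n^('n + 'n)"
  where "Zt \<equiv> Z_tilde S \<Psi> \<alpha>"

section \<open>Fundamental matrix, jump relation and square summable Weyl solutions\<close>

lemma nonhom_fund: "nonhom_solution S \<Psi> lam (\<lambda>_. 0) (\<lambda>k. fund S \<Psi> \<alpha> lam k *v c)"
proof -
  have "fund S \<Psi> \<alpha> lam k = S_coeff S \<Psi> lam k ** fund S \<Psi> \<alpha> lam (Suc k)" for k
    using fund_unique[of S \<Psi> "fund S \<Psi> \<alpha> lam" \<alpha> lam, OF S \<Psi>(2)] by blast
  then show ?thesis
    by (simp add: nonhom_solution_def matrix_vector_mul_assoc)
qed

lemma nonhom_X: "nonhom_solution S \<Psi> lam (\<lambda>_. 0) (\<lambda>k. X lam k *v c)"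
  using nonhom_fund[of lam "vcat (mat 1) (M lam) *v c"]
  by (simp add: weyl_sol_def matrix_vector_mul_assoc)

lemma nonhom_Zt: "nonhom_solution S \<Psi> lam (\<lambda>_. 0) (\<lambda>k. Zt lam k *v c)"
  using nonhom_fund[of lam "vcat 0 (mat 1) *v c"]
  by (simp add: Z_tilde_def right_block_eq_mult matrix_vector_mul_assoc)

text \<open>The four blocks reduce to \<open>\<alpha> ** adj \<alpha>\<close> and
  \<open>\<alpha> ** J ** adj \<alpha>\<close>, whose values are prescribed by
  \<open>\<Gamma>\<close>.\<close>

lemma fund_0_J: "adj (fund S \<Psi> \<alpha> lam 0) ** J ** fund S \<Psi> \<alpha> \<nu> 0 = J"
proof -
  have *: "\<alpha> ** adj \<alpha> = mat 1" "\<alpha> ** (J ** adj \<alpha>) = 0"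
    using \<alpha> by (auto simp: \<Gamma>_def matrix_mul_assoc)
  have JJ: "J ** (J ** A) = - A" for A :: "complex^'n^('n + 'n)"
    by (simp add: matrix_mul_assoc J_J matrix_minus_left)
  have "adj (- (J ** adj \<alpha>)) = \<alpha> ** J"
  proof -
    have "adj (- (J ** adj \<alpha>)) = - adj (J ** adj \<alpha>)"
      by (simp add: adj_def vec_eq_iff)
    then show ?thesis
      by (simp add: adj_mult adj_J matrix_minus_right)
  qed
  moreover have "hcat (vcat 0 (- mat 1)) (- vcat (- mat 1) 0) = (J :: 'n cmat2)"
  proof -
    have "hcat (vcat 0 (- mat 1)) (- vcat (- mat 1) 0) $ i $ j = (J :: 'n cmat2) $ i $ j" for i j
      by (cases i; cases j) (simp_all add: J_def vcat_def hcat_def)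
    then show ?thesis by (simp add: vec_eq_iff)
  qed
  ultimately show ?thesis
    by (simp add: adj_hcat vcat_mult mult_hcat matrix_minus_right matrix_minus_left JJ *
        flip: matrix_mul_assoc)
qed

text \<open>For the parameters \<open>lam\<close> and \<open>cnj lam\<close> the factor in front of
  the weighted sum in the Green identity is 0, so the form keeps its value from index 0.\<close>

lemma fund_J: "adj (fund S \<Psi> \<alpha> (cnj lam) k) ** J ** fund S \<Psi> \<alpha> lam k = J"
proof -
  have "(adj (fund S \<Psi> \<alpha> (cnj lam) k) ** J ** fund S \<Psi> \<alpha> lam k) *v v = J *v v" for v
  proof (rule cip_eqI)
    fix u
    have cip: "cip u ((adj A ** J ** B) *v v) = cip (A *v u) (J *v (B *v v))"
      for A B :: "'n cmat2"
      by (simp add: matrix_vector_mul_assoc[symmetric] cip_adj_right)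
    show "cip u ((adj (fund S \<Psi> \<alpha> (cnj lam) k) ** J ** fund S \<Psi> \<alpha> lam k) *v v) = cip u (J *v v)"
      using green_identity_sum[OF nonhom_fund[of lam v] nonhom_fund[of "cnj lam" u], of k]
        cip[of "fund S \<Psi> \<alpha> (cnj lam) 0" "fund S \<Psi> \<alpha> lam 0"]
      unfolding cip fund_0_J by simp
  qed
  then show ?thesis
    by (simp add: matrix_eq)
qed

text \<open>The two branches of the Green function differ by \<open>J\<close> on the diagonal, which
  produces the inhomogeneity. The symmetry of \<open>M\<close> under conjugation makes the
  contributions of \<open>M\<close> cancel.\<close>

lemma X_Zt_jump:
  assumes "lam \<notin> \<real>"
  shows "X lam k ** adj (Zt (cnj lam) k) - Zt lam k ** adj (X (cnj lam) k) = J"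
proof -
  let ?F = "fund S \<Psi> \<alpha>"
  have M': "M (cnj lam) = adj (M lam)"
    using M assms by (auto simp: half_line_M_def)
  have diff: "A ** (B - C) = A ** B - A ** C" "(B - C) ** D = B ** D - C ** D"
    for A B C D :: "'n cmat2"
    by (simp_all add: matrix_matrix_mult_def vec_eq_iff algebra_simps sum_subtractf)
  have "X lam k ** adj (Zt (cnj lam) k) - Zt lam k ** adj (X (cnj lam) k) =
    ?F lam k ** (vcat (mat 1) (M lam) ** adj (vcat 0 (mat 1)) -
      vcat 0 (mat 1) ** adj (vcat (mat 1) (adj (M lam)))) ** adj (?F (cnj lam) k)"
    by (simp add: weyl_sol_def Z_tilde_def right_block_eq_mult M' adj_mult diff matrix_mul_assoc)
  also have "\<dots> = J"
    unfolding vcat_adj_minus_eq_J by (rule J_unitary_right[OF fund_J])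
  finally show ?thesis .
qed

text \<open>The disk condition as a sign of the boundary form: multiplication by the imaginary unit
  turns its imaginary part, up to sign, into the real part tested by \<open>nsd\<close>.\<close>

lemma X_disk:
  assumes "lam \<notin> \<real>"
  shows "0 \<le> sgn (Im lam) * Im (cip (X lam k *v c) (J *v (X lam k *v c)))"
proof -
  let ?A = "adj (X lam k) ** J ** X lam k"
  have "M lam \<in> weyl_disk S \<Psi> \<alpha> lam k"
    using M assms by (auto simp: half_line_M_def limiting_disk_def)
  then have "Re (qform (mat (\<i> * of_real (sgn (Im lam))) ** ?A) c) \<le> 0"
    by (simp add: weyl_disk_def nsd_def E_form_def)
  moreover have "qform (mat (\<i> * of_real (sgn (Im lam))) ** ?A) c =
      (\<i> * of_real (sgn (Im lam))) * cip (X lam k *v c) (J *v (X lam k *v c))"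
    by (simp add: qform_cip matrix_vector_mul_assoc[symmetric] matrix_vector_mult_mat
        cip_scale_right cip_adj_right)
  ultimately show ?thesis by simp
qed

lemma sum_cip_qform: "(\<Sum>k<K. cip (z k) (\<Psi> k *v z k)) = of_real (\<Sum>k<K. Re (qform (\<Psi> k) (z k)))"
  unfolding of_real_sum by (simp add: psd_qform_real[OF \<Psi>(1), symmetric]) (simp add: qform_cip)

text \<open>In the Green identity of a Weyl solution with itself the weighted sum has the factor
  \<open>lam - cnj lam\<close>. By \<open>X_disk\<close> the boundary term at \<open>K\<close> has a
  favourable sign, so the term at 0 bounds all partial sums.\<close>

lemma X_l2:
  assumes "lam \<notin> \<real>"
  shows "(\<lambda>k. X lam k *v c) \<in> l2_space \<Psi>"
proof (rule l2_spaceI_bounded)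
  fix K
  let ?x = "\<lambda>k. X lam k *v c" and ?s = "sgn (Im lam)"
  let ?q = "\<Sum>k<K. Re (qform (\<Psi> k) (?x k))"
  have nz: "Im lam \<noteq> 0" using assms by (simp add: complex_is_Real_iff)
  have "cip (?x K) (J *v ?x K) = cip (?x 0) (J *v ?x 0) - (lam - cnj lam) * of_real ?q"
    using green_identity_sum[OF nonhom_X[of lam c] nonhom_X[of lam c], of K]
    by (simp add: sum_cip_qform)
  then have "Im (cip (?x K) (J *v ?x K)) = Im (cip (?x 0) (J *v ?x 0)) - 2 * Im lam * ?q"
    by simp
  then have "0 \<le> ?s * (Im (cip (?x 0) (J *v ?x 0)) - 2 * Im lam * ?q)"
    using X_disk[OF assms, of K c] by simp
  then have "2 * \<bar>Im lam\<bar> * ?q \<le> ?s * Im (cip (?x 0) (J *v ?x 0))"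
    by (simp add: algebra_simps abs_sgn)
  then show "?q \<le> ?s * Im (cip (?x 0) (J *v ?x 0)) / (2 * \<bar>Im lam\<bar>)"
    using nz by (simp add: field_simps)
qed

section \<open>The resolvent\<close>

abbreviation zh :: "complex \<Rightarrow> (nat \<Rightarrow> 'n cvec2) \<Rightarrow> nat \<Rightarrow> 'n cvec2"
  where "zh \<equiv> z_hat S \<Psi> \<alpha> M"

text \<open>For \<open>k \<le> l\<close> the index \<open>k\<close> enters the Green function
  through the left factor \<open>Zt lam k\<close> alone; this is the remaining factor applied to
  \<open>f\<close>, so one convergent series serves all \<open>k\<close>.\<close>

definition tail_term :: "complex \<Rightarrow> (nat \<Rightarrow> 'n cvec2) \<Rightarrow> nat \<Rightarrow> complex^'n"
  where "tail_term lam f l = adj (X (cnj lam) l) *v (\<Psi> l *v f l)"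

lemma green_below:
  "k \<le> l \<Longrightarrow> (green S \<Psi> \<alpha> M lam k l ** \<Psi> l) *v f l = Zt lam k *v tail_term lam f l"
  by (simp add: green_def tail_term_def matrix_vector_mul_assoc matrix_mul_assoc)

lemma green_above:
  "l < k \<Longrightarrow> (green S \<Psi> \<alpha> M lam k l ** \<Psi> l) *v f l =
    X lam k *v (adj (Zt (cnj lam) l) *v (\<Psi> l *v f l))"
  by (simp add: green_def matrix_vector_mul_assoc matrix_mul_assoc)

lemma cip_tail_term: "cip \<xi> (tail_term lam f l) = cip (X (cnj lam) l *v \<xi>) (\<Psi> l *v f l)"
  by (simp add: tail_term_def cip_adj_right)

text \<open>Each component pairs a column of the Weyl solution at \<open>cnj lam\<close> with
  \<open>f\<close>. Both are square summable, so Cauchy-Schwarz gives absolute convergence.\<close>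

lemma summable_tail_term:
  assumes "lam \<notin> \<real>" "f \<in> l2_space \<Psi>"
  shows "summable (tail_term lam f)"
proof (rule summable_comparison_test)
  show "\<exists>N. \<forall>l\<ge>N. norm (tail_term lam f l) \<le> (\<Sum>i\<in>UNIV. cmod (tail_term lam f l $ i))"
    by (auto simp: norm_vec_def intro!: L2_set_le_sum)
  have "summable (\<lambda>l. cmod (tail_term lam f l $ i))" for i
    using summable_norm_cip[OF X_l2[OF cnj_not_real[OF assms(1)]] assms(2), of "axis i 1"]
    by (simp only: cip_tail_term[symmetric] cip_axis_left)
  then show "summable (\<lambda>l. \<Sum>i\<in>UNIV. cmod (tail_term lam f l $ i))"
    by (intro summable_sum)
qed

lemma summable_green:
  assumes "lam \<notin> \<real>" "f \<in> l2_space \<Psi>"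
  shows "summable (\<lambda>l. (green S \<Psi> \<alpha> M lam k l ** \<Psi> l) *v f l)"
proof (rule summable_cong[THEN iffD1])
  show "\<forall>\<^sub>F l in sequentially. Zt lam k *v tail_term lam f l = (green S \<Psi> \<alpha> M lam k l ** \<Psi> l) *v f l"
    using eventually_ge_at_top[of k] by eventually_elim (simp add: green_below)
  show "summable (\<lambda>l. Zt lam k *v tail_term lam f l)"
    by (rule bounded_linear.summable[OF matrix_vector_mul_bounded_linear summable_tail_term[OF assms]])
qed

text \<open>Variation of constants: from \<open>k\<close> to \<open>Suc k\<close> the two
  coefficient vectors change by a single term each.\<close>

lemma z_hat_split:
  assumes "lam \<notin> \<real>" "f \<in> l2_space \<Psi>"
  shows "zh lam f k = X lam k *v (\<Sum>l<k. adj (Zt (cnj lam) l) *v (\<Psi> l *v f l))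
    + Zt lam k *v (\<Sum>l. tail_term lam f (l + k))"
proof -
  have "zh lam f k = (\<Sum>l. (green S \<Psi> \<alpha> M lam k (l + k) ** \<Psi> (l + k)) *v f (l + k))
      + (\<Sum>l<k. (green S \<Psi> \<alpha> M lam k l ** \<Psi> l) *v f l)"
    unfolding z_hat_def by (rule suminf_split_initial_segment[OF summable_green[OF assms]])
  also have "(\<Sum>l<k. (green S \<Psi> \<alpha> M lam k l ** \<Psi> l) *v f l) =
      X lam k *v (\<Sum>l<k. adj (Zt (cnj lam) l) *v (\<Psi> l *v f l))"
    by (simp add: green_above linear_sum[OF matrix_vector_mul_linear])
  also have "(\<Sum>l. (green S \<Psi> \<alpha> M lam k (l + k) ** \<Psi> (l + k)) *v f (l + k)) =
      Zt lam k *v (\<Sum>l. tail_term lam f (l + k))"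
    using bounded_linear.suminf[OF matrix_vector_mul_bounded_linear
        summable_ignore_initial_segment[OF summable_tail_term[OF assms]], of "Zt lam k" k]
    by (simp add: green_below)
  finally show ?thesis by simp
qed

lemma z_hat_solves:
  assumes "lam \<notin> \<real>" "f \<in> l2_space \<Psi>"
  shows "nonhom_solution S \<Psi> lam f (zh lam f)"
  unfolding nonhom_solution_def
proof
  fix k
  let ?t = "tail_term lam f" and ?S = "S_coeff S \<Psi> lam k"
  define a where "a k = (\<Sum>l<k. adj (Zt (cnj lam) l) *v (\<Psi> l *v f l))" for k
  define b where "b k = (\<Sum>l. ?t (l + k))" for k
  have zh: "zh lam f k = X lam k *v a k + Zt lam k *v b k" for k
    unfolding a_def b_def by (rule z_hat_split[OF assms])
  have b: "b k = b (Suc k) + ?t k"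
    using suminf_split_head[OF summable_ignore_initial_segment[OF summable_tail_term[OF assms]], of k]
    by (simp add: b_def)
  have X: "?S *v (X lam (Suc k) *v c) = X lam k *v c"
    and Zt: "?S *v (Zt lam (Suc k) *v c) = Zt lam k *v c" for c
    using nonhom_X[of lam c] nonhom_Zt[of lam c] unfolding nonhom_solution_def
    by (metis diff_zero matrix_vector_mult_0_right)+
  \<comment> \<open>The term with index \<open>k\<close> moves from the tail \<open>b\<close> to the
    head \<open>a\<close>; by the jump relation the net effect is the inhomogeneity.\<close>
  have "J *v (\<Psi> k *v f k) = X lam k *v (adj (Zt (cnj lam) k) *v (\<Psi> k *v f k)) - Zt lam k *v ?t k"
    unfolding X_Zt_jump[OF assms(1), of k, symmetric]
    by (simp add: tail_term_def matrix_vector_mult_diff_rdistrib flip: matrix_vector_mul_assoc)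
  then show "zh lam f k = ?S *v zh lam f (Suc k) - (J ** \<Psi> k) *v f k"
    unfolding zh
    by (simp add: b matrix_vector_right_distrib X Zt)
      (simp add: a_def matrix_vector_right_distrib flip: matrix_vector_mul_assoc)
qed

lemma z_hat_0:
  assumes "lam \<notin> \<real>" "f \<in> l2_space \<Psi>"
  shows "zh lam f 0 = Zt lam 0 *v (\<Sum>l. tail_term lam f l)"
  using z_hat_split[OF assms, of 0] by simp

lemma Zt_0: "Zt lam 0 = - (J ** adj \<alpha>)"
  by (simp add: Z_tilde_def right_block_def hcat_def vec_eq_iff)

lemma \<alpha>_z_hat_0:
  assumes "lam \<notin> \<real>" "f \<in> l2_space \<Psi>"
  shows "\<alpha> *v zh lam f 0 = 0"
proof -
  have "\<alpha> ** Zt lam 0 = 0"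
    using \<alpha> by (simp add: Zt_0 \<Gamma>_def matrix_minus_right matrix_mul_assoc)
  then show ?thesis
    by (simp add: z_hat_0[OF assms] matrix_vector_mul_assoc)
qed

text \<open>\<open>J\<close> maps the initial value for \<open>g\<close> into the range of
  \<open>adj \<alpha>\<close>, while \<open>\<alpha>\<close> annihilates the initial value for
  \<open>f\<close>. This removes the boundary term at 0 from the Green identity.\<close>

lemma cip_J_z_hat_0:
  assumes "lam \<notin> \<real>" "f \<in> l2_space \<Psi>" "g \<in> l2_space \<Psi>"
  shows "cip (zh lam f 0) (J *v zh lam g 0) = 0"
proof -
  let ?b = "\<Sum>l. tail_term lam g l"
  have "J *v zh lam g 0 = adj \<alpha> *v ?b"
    by (simp add: z_hat_0 assms Zt_0 matrix_vector_mult_minus_left matrix_vector_mult_minus_right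
        J_J_vec flip: matrix_vector_mul_assoc)
  then show ?thesis
    by (simp add: cip_adj_right \<alpha>_z_hat_0 assms)
qed

section \<open>Truncated right-hand sides and the norm bound\<close>

definition trunc :: "nat \<Rightarrow> (nat \<Rightarrow> 'n cvec2) \<Rightarrow> nat \<Rightarrow> 'n cvec2"
  where "trunc N f l = (if l < N then f l else 0)"

lemma qform_trunc: "Re (qform (\<Psi> l) (trunc N f l)) = (if l < N then Re (qform (\<Psi> l) (f l)) else 0)"
  by (simp add: trunc_def qform_cip)

lemma trunc_l2: "trunc N f \<in> l2_space \<Psi>"
  unfolding l2_space_iff qform_trunc by (rule summable_finite[of "{..<N}"]) auto

lemma l2_norm_trunc: "l2_norm \<Psi> (trunc N f) = sqrt (\<Sum>l<N. Re (qform (\<Psi> l) (f l)))"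
  unfolding l2_norm_def qform_trunc
  by (subst suminf_finite[of "{..<N}"]) auto

lemma z_hat_trunc: "zh lam (trunc N f) k = (\<Sum>l<N. (green S \<Psi> \<alpha> M lam k l ** \<Psi> l) *v f l)"
  unfolding z_hat_def by (subst suminf_finite[of "{..<N}"]) (auto simp: trunc_def)

text \<open>From \<open>N\<close> on, every index in the support of the truncation is below
  \<open>k\<close>, so only the branch with the factor \<open>X lam k\<close> contributes, and
  \<open>c\<close> does not depend on \<open>k\<close>.\<close>

lemma z_hat_trunc_X:
  obtains c where "\<And>k. N \<le> k \<Longrightarrow> zh lam (trunc N f) k = X lam k *v c"
proof
  fix k assume "N \<le> k"
  then show "zh lam (trunc N f) k = X lam k *v (\<Sum>l<N. adj (Zt (cnj lam) l) *v (\<Psi> l *v f l))"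
    by (simp add: z_hat_trunc green_above linear_sum[OF matrix_vector_mul_linear])
qed

lemma z_hat_trunc_bound:
  assumes lam: "lam \<notin> \<real>"
  shows "sqrt (\<Sum>k<K. Re (qform (\<Psi> k) (zh lam (trunc N f) k))) \<le>
    l2_norm \<Psi> (trunc N f) / \<bar>Im lam\<bar>"
proof -
  let ?f = "trunc N f" and ?s = "sgn (Im lam)"
  let ?z = "zh lam ?f"
  let ?A = "\<lambda>K. \<Sum>k<K. Re (qform (\<Psi> k) (?z k))"
  have nz: "Im lam \<noteq> 0" using lam by (simp add: complex_is_Real_iff)
  have A0: "0 \<le> ?A K" for K
    by (intro sum_nonneg psd_qform_nonneg \<Psi>)
  note sol = z_hat_solves[OF lam trunc_l2[of N f]]
  \<comment> \<open>For \<open>N \<le> K\<close> the value at \<open>K\<close> is that of a Weyl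
    solution and \<open>X_disk\<close> applies; smaller \<open>K\<close> follow by
    monotonicity.\<close>
  have *: "sqrt (?A K) \<le> l2_norm \<Psi> ?f / \<bar>Im lam\<bar>" if "N \<le> K" for K
  proof -
    let ?B = "\<Sum>k<K. cip (?f k) (\<Psi> k *v ?z k)"
    have conj: "(\<Sum>k<K. cip (?z k) (\<Psi> k *v ?f k)) = cnj ?B"
      by (simp add: cip_commute \<Psi>_cip_left[symmetric])
    have "cip (?z K) (J *v ?z K) = - cnj ?B + ?B - (lam - cnj lam) * of_real (?A K)"
      using green_identity_sum[OF sol sol, of K] cip_J_z_hat_0[OF lam trunc_l2 trunc_l2, of N f N f]
      unfolding conj sum_cip_qform by simp
    then have "Im (cip (?z K) (J *v ?z K)) = 2 * Im ?B - 2 * Im lam * ?A K"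
      by (simp add: sum_negf)
    moreover obtain c where "?z K = X lam K *v c"
      using z_hat_trunc_X[of N lam f] \<open>N \<le> K\<close> by metis
    ultimately have "0 \<le> ?s * (2 * Im ?B - 2 * Im lam * ?A K)"
      using X_disk[OF lam, of K c] by simp
    then have "\<bar>Im lam\<bar> * ?A K \<le> ?s * Im ?B"
      by (simp add: algebra_simps abs_sgn)
    also have "\<dots> \<le> \<bar>Im ?B\<bar>"
      using nz by (simp add: sgn_if del: Im_sum) linarith
    also have "\<dots> \<le> cmod ?B"
      by (rule abs_Im_le_cmod)
    also have "\<dots> \<le> sqrt (\<Sum>k<K. Re (qform (\<Psi> k) (?f k))) * sqrt (?A K)"
      using norm_sum sum_cip_le_partial by (rule order_trans)
    also have "\<dots> \<le> l2_norm \<Psi> ?f * sqrt (?A K)"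
      using A0 by (intro mult_right_mono sum_qform_le_l2_norm trunc_l2) auto
    finally have le: "(\<bar>Im lam\<bar> * sqrt (?A K)) * sqrt (?A K) \<le> l2_norm \<Psi> ?f * sqrt (?A K)"
      using A0[of K] by (simp add: mult.assoc)
    \<comment> \<open>Cancelling the common factor \<open>sqrt (?A K)\<close> requires it to be
      positive.\<close>
    show ?thesis
    proof (cases "?A K = 0")
      case True
      then show ?thesis using l2_norm_nonneg[OF trunc_l2, of N f] by simp
    next
      case False
      then have "0 < sqrt (?A K)" using A0[of K] by simp
      then have "\<bar>Im lam\<bar> * sqrt (?A K) \<le> l2_norm \<Psi> ?f"
        using le by (simp only: mult_le_cancel_right_pos)
      then show ?thesis using nz by (simp add: field_simps)
    qed
  qed
  have "sqrt (?A K) \<le> sqrt (?A (max K N))"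
    by (intro real_sqrt_le_mono sum_mono2) (auto simp: psd_qform_nonneg[OF \<Psi>(1)])
  also have "\<dots> \<le> l2_norm \<Psi> ?f / \<bar>Im lam\<bar>"
    by (rule *) simp
  finally show ?thesis .
qed

text \<open>For fixed \<open>K\<close> only finitely many continuous forms occur, so pointwise
  convergence of the truncated solutions carries the bound over. Square summability is then a
  consequence.\<close>

lemma z_hat_bound:
  assumes lam: "lam \<notin> \<real>" and f: "f \<in> l2_space \<Psi>"
  shows "(\<Sum>k<K. Re (qform (\<Psi> k) (zh lam f k))) \<le> (l2_norm \<Psi> f / \<bar>Im lam\<bar>)\<^sup>2"
proof (rule LIMSEQ_le_const2)
  have zh: "(\<lambda>N. zh lam (trunc N f) k) \<longlonglongrightarrow> zh lam f k" for k
    unfolding z_hat_trunc unfolding z_hat_def by (rule summable_LIMSEQ[OF summable_green[OF lam f]])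
  show "(\<lambda>N. \<Sum>k<K. Re (qform (\<Psi> k) (zh lam (trunc N f) k))) \<longlonglongrightarrow>
      (\<Sum>k<K. Re (qform (\<Psi> k) (zh lam f k)))"
    unfolding qform_cip cip_def
    by (intro tendsto_sum tendsto_Re tendsto_mult tendsto_cnj tendsto_vec_nth zh
        bounded_linear.tendsto[OF matrix_vector_mul_bounded_linear])
  have "(\<Sum>k<K. Re (qform (\<Psi> k) (zh lam (trunc N f) k))) \<le> (l2_norm \<Psi> f / \<bar>Im lam\<bar>)\<^sup>2" for N
  proof (rule sqrt_le_D)
    have "l2_norm \<Psi> (trunc N f) \<le> l2_norm \<Psi> f"
      unfolding l2_norm_trunc by (rule sum_qform_le_l2_norm[OF f])
    then show "sqrt (\<Sum>k<K. Re (qform (\<Psi> k) (zh lam (trunc N f) k))) \<le> l2_norm \<Psi> f / \<bar>Im lam\<bar>"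
      using z_hat_trunc_bound[OF lam, of N f K] by (meson abs_ge_zero divide_right_mono order_trans)
  qed
  then show "\<exists>N. \<forall>n\<ge>N. (\<Sum>k<K. Re (qform (\<Psi> k) (zh lam (trunc n f) k))) \<le> (l2_norm \<Psi> f / \<bar>Im lam\<bar>)\<^sup>2"
    by (intro exI allI impI)
qed

lemma z_hat_l2: "lam \<notin> \<real> \<Longrightarrow> f \<in> l2_space \<Psi> \<Longrightarrow> zh lam f \<in> l2_space \<Psi>"
  by (rule l2_spaceI_bounded) (rule z_hat_bound)

lemma z_hat_norm_le:
  assumes "lam \<notin> \<real>" "f \<in> l2_space \<Psi>"
  shows "l2_norm \<Psi> (zh lam f) \<le> l2_norm \<Psi> f / \<bar>Im lam\<bar>"
proof -
  have "(\<Sum>k. Re (qform (\<Psi> k) (zh lam f k))) \<le> (l2_norm \<Psi> f / \<bar>Im lam\<bar>)\<^sup>2"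
    using z_hat_bound[OF assms] z_hat_l2[OF assms]
    by (intro suminf_le_const) (auto simp: l2_space_iff)
  then show ?thesis
    unfolding l2_norm_def[of _ "zh lam f"]
    by (intro real_le_lsqrt) (simp_all add: l2_norm_nonneg assms)
qed

section \<open>The boundary condition at infinity\<close>

text \<open>The Green identity reduces the form at \<open>k\<close> to the form at 0 and two sums.
  Cauchy-Schwarz bounds the sums, and the form at 0 is itself a pairing of a Weyl solution with
  \<open>f\<close>.\<close>

lemma cip_X_z_hat_bound:
  assumes lam: "lam \<notin> \<real>" and \<nu>: "\<nu> \<notin> \<real>"
  obtains C where "\<And>f k. f \<in> l2_space \<Psi> \<Longrightarrow>
    cmod (cip (X \<nu> k *v c) (J *v zh lam f k)) \<le> C * l2_norm \<Psi> f"
proof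
  fix f K assume f: "f \<in> l2_space \<Psi>"
  let ?w = "\<lambda>k. X \<nu> k *v c" and ?z = "zh lam f"
  \<comment> \<open>Chosen to move \<open>J\<close> and \<open>Zt lam 0\<close> to the left
    argument, which leaves \<open>\<xi>\<close> paired with the sum of the tail terms.\<close>
  define \<xi> where "\<xi> = adj (Zt lam 0) *v (adj J *v ?w 0)"
  let ?y = "\<lambda>k. X (cnj lam) k *v \<xi>"
  have w: "?w \<in> l2_space \<Psi>" and y: "?y \<in> l2_space \<Psi>" and z: "?z \<in> l2_space \<Psi>"
    using X_l2[OF \<nu>] X_l2[OF cnj_not_real[OF lam]] z_hat_l2[OF lam f] by auto
  have "cip (?w 0) (J *v ?z 0) = cip \<xi> (\<Sum>l. tail_term lam f l)"
    unfolding z_hat_0[OF lam f] \<xi>_def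
    by (simp flip: cip_adj_right)
  also have "\<dots> = (\<Sum>l. cip (?y l) (\<Psi> l *v f l))"
    unfolding cip_tail_term[symmetric]
    by (rule bounded_linear.suminf[OF bounded_linear_cip summable_tail_term[OF lam f]])
  also have "cmod \<dots> \<le> (\<Sum>l. cmod (cip (?y l) (\<Psi> l *v f l)))"
    by (rule summable_norm[OF summable_norm_cip[OF y f]])
  also have "\<dots> \<le> l2_norm \<Psi> ?y * l2_norm \<Psi> f"
    by (rule suminf_le_const[OF summable_norm_cip[OF y f] sum_cip_le[OF y f]])
  finally have 1: "cmod (cip (?w 0) (J *v ?z 0)) \<le> l2_norm \<Psi> ?y * l2_norm \<Psi> f" .
  have 2: "cmod (\<Sum>k<K. cip (?w k) (\<Psi> k *v f k)) \<le> l2_norm \<Psi> ?w * l2_norm \<Psi> f"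
    by (rule norm_sum_cip_le[OF w f])
  have "cmod (\<Sum>k<K. cip (?w k) (\<Psi> k *v ?z k)) \<le> l2_norm \<Psi> ?w * l2_norm \<Psi> ?z"
    by (rule norm_sum_cip_le[OF w z])
  also have "\<dots> \<le> l2_norm \<Psi> ?w * (l2_norm \<Psi> f / \<bar>Im lam\<bar>)"
    by (rule mult_left_mono[OF z_hat_norm_le[OF lam f] l2_norm_nonneg[OF w]])
  finally have 3: "cmod ((lam - cnj \<nu>) * (\<Sum>k<K. cip (?w k) (\<Psi> k *v ?z k))) \<le>
      cmod (lam - cnj \<nu>) * (l2_norm \<Psi> ?w * (l2_norm \<Psi> f / \<bar>Im lam\<bar>))"
    unfolding norm_mult by (rule mult_left_mono) simp
  have "cip (?w K) (J *v ?z K) = cip (?w 0) (J *v ?z 0) - (\<Sum>k<K. cip (?w k) (\<Psi> k *v f k))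
      - (lam - cnj \<nu>) * (\<Sum>k<K. cip (?w k) (\<Psi> k *v ?z k))"
    using green_identity_sum[OF z_hat_solves[OF lam f] nonhom_X[of \<nu> c], of K] by simp
  then have "cmod (cip (?w K) (J *v ?z K)) \<le> l2_norm \<Psi> ?y * l2_norm \<Psi> f
      + l2_norm \<Psi> ?w * l2_norm \<Psi> f
      + cmod (lam - cnj \<nu>) * (l2_norm \<Psi> ?w * (l2_norm \<Psi> f / \<bar>Im lam\<bar>))"
    using 1 2 3 by (smt (verit) norm_triangle_ineq4)
  also have "\<dots> = (l2_norm \<Psi> ?y + l2_norm \<Psi> ?w + cmod (lam - cnj \<nu>) * l2_norm \<Psi> ?w / \<bar>Im lam\<bar>)
      * l2_norm \<Psi> f"
    by (simp add: algebra_simps)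
  \<comment> \<open>The vector \<open>\<xi>\<close> is local to this block; unfolding it shows a
    constant independent of \<open>f\<close> and \<open>K\<close>.\<close>
  finally show "cmod (cip (?w K) (J *v ?z K)) \<le>
      (l2_norm \<Psi> (\<lambda>k. X (cnj lam) k *v (adj (Zt lam 0) *v (adj J *v (X \<nu> 0 *v c))))
        + l2_norm \<Psi> ?w + cmod (lam - cnj \<nu>) * l2_norm \<Psi> ?w / \<bar>Im lam\<bar>) * l2_norm \<Psi> f"
    unfolding \<xi>_def .
qed

lemma trunc_tail:
  assumes "f \<in> l2_space \<Psi>"
  shows trunc_tail_l2: "f - trunc N f \<in> l2_space \<Psi>"
    and trunc_tail_norm: "(\<lambda>N. l2_norm \<Psi> (f - trunc N f)) \<longlonglongrightarrow> 0"
proof -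
  let ?q = "\<lambda>l. Re (qform (\<Psi> l) (f l))"
  have sum: "summable ?q" using assms by (simp add: l2_space_iff)
  have q: "Re (qform (\<Psi> l) ((f - trunc N f) l)) = ?q l - (if l < N then ?q l else 0)" for N l
    by (simp add: trunc_def qform_cip)
  have fin: "(\<lambda>l. if l < N then ?q l else 0) sums (\<Sum>l<N. ?q l)" for N
    using sums_If_finite_set[of "{..<N}" ?q] by simp
  have sums: "(\<lambda>l. Re (qform (\<Psi> l) ((f - trunc N f) l))) sums (suminf ?q - (\<Sum>l<N. ?q l))" for N
    unfolding q by (intro sums_diff summable_sums[OF sum] fin)
  then show "f - trunc N f \<in> l2_space \<Psi>"
    unfolding l2_space_iff by (rule sums_summable)
  have "(\<lambda>N. sqrt (suminf ?q - (\<Sum>l<N. ?q l))) \<longlonglongrightarrow> sqrt (suminf ?q - suminf ?q)"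
    by (intro tendsto_intros summable_LIMSEQ[OF sum])
  then show "(\<lambda>N. l2_norm \<Psi> (f - trunc N f)) \<longlonglongrightarrow> 0"
    unfolding l2_norm_def sums_unique[OF sums, symmetric] by simp
qed

lemma z_hat_add:
  assumes "lam \<notin> \<real>" "f \<in> l2_space \<Psi>" "g \<in> l2_space \<Psi>"
  shows "zh lam (f + g) k = zh lam f k + zh lam g k"
  using suminf_add[OF summable_green[OF assms(1,2), of k] summable_green[OF assms(1,3), of k]]
  by (simp add: z_hat_def matrix_vector_right_distrib)

text \<open>The limit point and limit circle cases are covered together by the hypothesis
  \<open>lim\<close>.\<close>

lemma X_J_z_hat_tendsto:
  assumes lam: "lam \<notin> \<real>" and \<nu>: "\<nu> \<notin> \<real>" and f: "f \<in> l2_space \<Psi>"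
    and lim: "(\<lambda>k. adj (X \<nu> k) ** J ** X lam k) \<longlonglongrightarrow> 0"
  shows "(\<lambda>k. (adj (X \<nu> k) ** J) *v zh lam f k) \<longlonglongrightarrow> 0"
proof (rule vec_tendstoI)
  fix i
  let ?e = "axis i 1 :: complex^'n"
  have comp: "((adj (X \<nu> k) ** J) *v v) $ i = cip (X \<nu> k *v ?e) (J *v v)" for k v
    by (simp add: cip_axis_left cip_adj_right[symmetric] matrix_vector_mul_assoc)
  obtain C where C: "\<And>g k. g \<in> l2_space \<Psi> \<Longrightarrow>
      cmod (cip (X \<nu> k *v ?e) (J *v zh lam g k)) \<le> C * l2_norm \<Psi> g"
    using cip_X_z_hat_bound[OF lam \<nu>, of ?e] by metis
  show "(\<lambda>k. ((adj (X \<nu> k) ** J) *v zh lam f k) $ i) \<longlonglongrightarrow> 0 $ i"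
    unfolding comp
  proof (rule tendstoI)
    fix e :: real assume "0 < e"
    have "(\<lambda>N. C * l2_norm \<Psi> (f - trunc N f)) \<longlonglongrightarrow> C * 0"
      by (intro tendsto_intros trunc_tail_norm f)
    then have "\<forall>\<^sub>F N in sequentially. C * l2_norm \<Psi> (f - trunc N f) < e / 2"
      using \<open>0 < e\<close> by (intro order_tendstoD) auto
    \<comment> \<open>One \<open>N\<close> serves all \<open>k\<close>, because \<open>C\<close> is
      uniform in \<open>k\<close>; only then is \<open>k\<close> taken large.\<close>
    then obtain N where N: "C * l2_norm \<Psi> (f - trunc N f) < e / 2"
      by (auto simp: eventually_sequentially)
    obtain c where c: "\<And>k. N \<le> k \<Longrightarrow> zh lam (trunc N f) k = X lam k *v c"
      using z_hat_trunc_X[of N lam f] by metis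
    \<comment> \<open>With \<open>N\<close> fixed the vector \<open>c\<close> is constant, so
      \<open>lim\<close> disposes of the truncated part.\<close>
    have "(\<lambda>k. ((adj (X \<nu> k) ** J ** X lam k) *v c) $ i) \<longlonglongrightarrow> 0"
    proof -
      have "(\<lambda>k. \<Sum>j\<in>UNIV. (adj (X \<nu> k) ** J ** X lam k) $ i $ j * c $ j) \<longlonglongrightarrow>
          (\<Sum>j\<in>UNIV. (0 :: complex^'n^'n) $ i $ j * c $ j)"
        by (intro tendsto_intros lim)
      then show ?thesis by (simp add: matrix_vector_mult_def)
    qed
    then have "\<forall>\<^sub>F k in sequentially. cmod (((adj (X \<nu> k) ** J ** X lam k) *v c) $ i) < e / 2"
      using \<open>0 < e\<close> by (intro order_tendstoD(2)[OF tendsto_norm_zero]) auto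
    then show "\<forall>\<^sub>F k in sequentially. dist (cip (X \<nu> k *v ?e) (J *v zh lam f k)) (0 $ i) < e"
      using eventually_ge_at_top[of N]
    proof eventually_elim
      case (elim k)
      have "((adj (X \<nu> k) ** J ** X lam k) *v c) $ i = cip (X \<nu> k *v ?e) (J *v zh lam (trunc N f) k)"
        unfolding c[OF elim(2)] comp[symmetric] by (simp add: matrix_vector_mul_assoc)
      then have "cmod (cip (X \<nu> k *v ?e) (J *v zh lam (trunc N f) k)) < e / 2"
        using elim(1) by simp
      moreover have "cmod (cip (X \<nu> k *v ?e) (J *v zh lam (f - trunc N f) k)) < e / 2"
        using C[OF trunc_tail_l2[OF f, of N], of k] N by linarith
      moreover have "zh lam f k = zh lam (trunc N f) k + zh lam (f - trunc N f) k"
        using z_hat_add[OF lam trunc_l2 trunc_tail_l2[OF f], of N f N k] by simp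
      ultimately show ?case
        by (simp add: matrix_vector_right_distrib cip_add_right)
          (smt (verit) norm_triangle_ineq)
    qed
  qed
qed

end

text \<open>The summability clause ensures that \<open>z_hat\<close> is a genuine sum, since
  \<open>suminf\<close> is a total function with an unspecified value on divergent series.\<close>

theorem theorem4p3:
  fixes S \<Psi> :: "nat \<Rightarrow> complex^('n::finite + 'n)^('n + 'n)"
    and \<alpha> :: "complex^('n + 'n)^'n"
    and M :: "complex \<Rightarrow> complex^'n^'n"
    and lam :: complex
    and f :: "nat \<Rightarrow> complex^('n + 'n)"
  assumes S: "\<And>k. adj (S k) ** J ** S k = J"
    and \<Psi>: "\<And>k. psd (\<Psi> k)" "\<And>k. \<Psi> k ** J ** \<Psi> k = 0"
    and \<alpha>: "\<alpha> \<in> \<Gamma>"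
    and M: "half_line_M S \<Psi> \<alpha> M"
    and lam: "lam \<notin> \<real>"
    and f: "f \<in> l2_space \<Psi>"
    and definite: "definite S \<Psi>"
  shows "(\<forall>k. summable (\<lambda>l. (green S \<Psi> \<alpha> M lam k l ** \<Psi> l) *v f l)) \<and>
    nonhom_solution S \<Psi> lam f (z_hat S \<Psi> \<alpha> M lam f) \<and>
    \<alpha> *v z_hat S \<Psi> \<alpha> M lam f 0 = 0 \<and>
    z_hat S \<Psi> \<alpha> M lam f \<in> l2_space \<Psi> \<and>
    l2_norm \<Psi> (z_hat S \<Psi> \<alpha> M lam f) \<le> 1 / \<bar>Im lam\<bar> * l2_norm \<Psi> f \<and>
    ((\<forall>\<mu>. \<mu> \<notin> \<real> \<longrightarrow> limit_point S \<Psi> \<mu>) \<or> (\<forall>\<mu>. \<mu> \<notin> \<real> \<longrightarrow> limit_circle S \<Psi> \<mu>) \<longrightarrow>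
      (\<forall>\<nu>. \<nu> \<notin> \<real> \<longrightarrow>
        (\<lambda>k. (adj (weyl_sol S \<Psi> \<alpha> \<nu> (M \<nu>) k) ** J) *v z_hat S \<Psi> \<alpha> M lam f k) \<longlonglongrightarrow> 0))"
proof -
  interpret half_line_system S \<Psi> \<alpha> M
    by unfold_locales (fact S \<Psi> \<alpha> M)+
  have "(\<lambda>k. (adj (X \<nu> k) ** J) *v zh lam f k) \<longlonglongrightarrow> 0"
    if "(\<forall>\<mu>. \<mu> \<notin> \<real> \<longrightarrow> limit_point S \<Psi> \<mu>) \<or> (\<forall>\<mu>. \<mu> \<notin> \<real> \<longrightarrow> limit_circle S \<Psi> \<mu>)" "\<nu> \<notin> \<real>" for \<nu>
  proof (rule X_J_z_hat_tendsto[OF lam that(2) f])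
    show "(\<lambda>k. adj (X \<nu> k) ** J ** X lam k) \<longlonglongrightarrow> 0"
      using M that lam unfolding half_line_M_def by blast
  qed
  then show ?thesis
    using summable_green[OF lam f] z_hat_solves[OF lam f] \<alpha>_z_hat_0[OF lam f] z_hat_l2[OF lam f]
      z_hat_norm_le[OF lam f] by simp
qed

end
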